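(* Let $n,t$ be integers with $1<t<n-1$ and let $K$ be a field. Consider the $K$-algebra homomorphism $\varphi':R=K[y_1,\ldots,y_n]\to F(I_t(C_n))\cong K[u_1,\ldots,u_n]$ given by $\varphi'(y_i)=u_i=x_ix_{i+1}\cdots x_{i+t-1}$ for $i=1,\ldots,n$ (indices modulo $n$). Let $d=\gcd(n,t)$ and, for $i=1,\ldots,d$, let $$m_i=\prod_{\substack{1\le j\le n\\ j\equiv i\ (\mathrm{mod}\ d)}}y_j .$$ Then the defining ideal $H=\ker(\varphi')$ of $F(I_t(C_n))$ coincides with the ideal $H'=(m_1-m_d,\,m_2-m_d,\ldots,m_{d-1}-m_d)$ of $R$ (so that $H'=0$ when $d=1$).
   Context: Let $S=K[x_1,\ldots,x_n]$ with $K$ a field, and $\mathfrak m=(x_1,\ldots,x_n)$. $C_n$ is the cycle on vertices $x_1,\ldots,x_n$ with edges $\{x_i,x_{i+1}\}$, indices taken modulo $n$. The $t$-path ideal $I_t(C_n)\subset S$ is the ideal generated by the $n$ monomials $u_j=x_jx_{j+1}\cdots x_{j+t-1}$, $j=1,\ldots,n$ (indices modulo $n$). For an ideal $I=(u_1,\ldots,u_m)$ of $S$, the Rees algebra is $R(I)=S[u_1s,\ldots,u_ms]\subset S[s]$, and the fiber cone is $F(I)=R(I)/\mathfrak mR(I)$. Since $I_t(C_n)$ is generated in a single degree, $F(I_t(C_n))$ is identified with the subalgebra $K[u_1,\ldots,u_n]\subset S$. *)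

theory Defs
  imports
    "HOL-Algebra.Algebraic_Closure_Type"
    "HOL-Algebra.Generated_Rings"
    "HOL-Library.Poly_Mapping"
    "HOL-Number_Theory.Cong"
begin

section \<open>Polynomial rings\<close>

text \<open>
  A monomial is a finitely supported exponent function on variable indices; multiplication of
  finitely supported functions is convolution, hence multiplication of polynomials.
\<close>

type_synonym 'k mpoly = "(nat \<Rightarrow>\<^sub>0 nat) \<Rightarrow>\<^sub>0 'k"

definition mconst :: "'k::zero \<Rightarrow> 'k mpoly" where
  "mconst c = Poly_Mapping.single 0 c"

definition mvar :: "nat \<Rightarrow> 'k::zero_neq_one mpoly" where
  "mvar i = Poly_Mapping.single (Poly_Mapping.single i 1) 1"

definition mpoly_ring :: "nat \<Rightarrow> 'k::field mpoly ring" where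
  "mpoly_ring n = ring_of_type_algebra
     \<lparr>carrier := {p. \<forall>m \<in> Poly_Mapping.keys p. Poly_Mapping.keys m \<subseteq> {1..n}}\<rparr>"

text \<open>Substitution of \<open>g i\<close> for the variable \<open>i\<close>, where \<open>h\<close> embeds the coefficients.\<close>

definition mpoly_subst ::
    "('k::zero \<Rightarrow> 'b::comm_semiring_1) \<Rightarrow> (nat \<Rightarrow> 'b) \<Rightarrow> 'k mpoly \<Rightarrow> 'b" where
  "mpoly_subst h g p =
     (\<Sum>m \<in> Poly_Mapping.keys p. h (Poly_Mapping.lookup p m) *
        (\<Prod>i \<in> Poly_Mapping.keys m. g i ^ Poly_Mapping.lookup m i))"

section \<open>Rees algebra and fiber cone\<close>

text \<open>The ring \<open>S[s]\<close>, where \<open>S = mpoly_ring n\<close>; the variable \<open>s\<close> is \<open>[:0, 1:]\<close>.\<close>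

definition poly_ring_over :: "nat \<Rightarrow> 'k::field mpoly poly ring" where
  "poly_ring_over n = ring_of_type_algebra
     \<lparr>carrier := {p. \<forall>i. Polynomial.coeff p i \<in> carrier (mpoly_ring n)}\<rparr>"

text \<open>
  In the Rees algebra and the fiber cone, \<open>U\<close> is a set of generators of the ideal in question. The Rees
  algebra depends only on that ideal, see \<open>rees_algebra_genideal\<close> below.
\<close>

definition rees_algebra :: "nat \<Rightarrow> 'k::field mpoly set \<Rightarrow> 'k mpoly poly ring" where
  "rees_algebra n U = (poly_ring_over n)
     \<lparr>carrier := generate_ring (poly_ring_over n)
        ((\<lambda>a. [:a:]) ` carrier (mpoly_ring n) \<union> (\<lambda>u. [:0, u:]) ` U)\<rparr>"

definition max_ideal :: "nat \<Rightarrow> 'k::field mpoly set" where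
  "max_ideal n = Idl\<^bsub>mpoly_ring n\<^esub> (mvar ` {1..n})"

definition rees_max_ideal :: "nat \<Rightarrow> 'k::field mpoly set \<Rightarrow> 'k mpoly poly set" where
  "rees_max_ideal n U = Idl\<^bsub>rees_algebra n U\<^esub> ((\<lambda>a. [:a:]) ` max_ideal n)"

definition fiber_cone :: "nat \<Rightarrow> 'k::field mpoly set \<Rightarrow> 'k mpoly poly set ring" where
  "fiber_cone n U = rees_algebra n U Quot rees_max_ideal n U"

definition subalgebra_ring :: "nat \<Rightarrow> 'k::field mpoly set \<Rightarrow> 'k mpoly ring" where
  "subalgebra_ring n U = (mpoly_ring n)
     \<lparr>carrier := generate_ring (mpoly_ring n) (range mconst \<union> U)\<rparr>"

section \<open>Path ideals of cycles\<close>

text \<open>The representative of \<open>i\<close> modulo \<open>n\<close> in \<open>{1..n}\<close>.\<close>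

definition cyc :: "nat \<Rightarrow> nat \<Rightarrow> nat" where
  "cyc n i = (if n dvd i then n else i mod n)"

definition path_gen :: "nat \<Rightarrow> nat \<Rightarrow> nat \<Rightarrow> 'k::field mpoly" where
  "path_gen n t j = (\<Prod>k<t. mvar (cyc n (j + k)))"

definition path_gens :: "nat \<Rightarrow> nat \<Rightarrow> 'k::field mpoly set" where
  "path_gens n t = path_gen n t ` {1..n}"

text \<open>
  The homomorphism \<open>y\<^sub>i \<mapsto> u\<^sub>i\<close>, first with values in the fiber cone (where \<open>u\<^sub>i\<close> stands for the
  residue class of \<open>u\<^sub>i s\<close>), then with values in \<open>K[u\<^sub>1, \<dots>, u\<^sub>n]\<close>.
\<close>

definition fiber_map :: "nat \<Rightarrow> nat \<Rightarrow> 'k::field mpoly \<Rightarrow> 'k mpoly poly set" where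
  "fiber_map n t f =
     rees_max_ideal n (path_gens n t) +>\<^bsub>rees_algebra n (path_gens n t)\<^esub>
       mpoly_subst (\<lambda>c. [:mconst c:]) (\<lambda>i. [:0, path_gen n t i:]) f"

definition path_map :: "nat \<Rightarrow> nat \<Rightarrow> 'k::field mpoly \<Rightarrow> 'k mpoly" where
  "path_map n t = mpoly_subst mconst (path_gen n t)"

definition residue_monom :: "nat \<Rightarrow> nat \<Rightarrow> nat \<Rightarrow> 'k::field mpoly" where
  "residue_monom n d i = (\<Prod>j | j \<in> {1..n} \<and> [j = i] (mod d). mvar j)"

section \<open>Consistency of the definitions\<close>

lemma mpoly_ring_simps [simp]:
  "monoid.mult (mpoly_ring n) = (*)" "one (mpoly_ring n) = 1"
  "zero (mpoly_ring n) = 0" "add (mpoly_ring n) = (+)"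
  by (simp_all add: mpoly_ring_def ring_of_type_algebra_def)

lemma poly_ring_over_simps [simp]:
  "monoid.mult (poly_ring_over n) = (*)" "one (poly_ring_over n) = 1"
  "zero (poly_ring_over n) = 0" "add (poly_ring_over n) = (+)"
  by (simp_all add: poly_ring_over_def ring_of_type_algebra_def)

lemma rees_algebra_simps [simp]:
  "monoid.mult (rees_algebra n U) = (*)" "one (rees_algebra n U) = 1"
  "zero (rees_algebra n U) = 0" "add (rees_algebra n U) = (+)"
  by (simp_all add: rees_algebra_def)

lemma subalgebra_ring_simps [simp]:
  "monoid.mult (subalgebra_ring n U) = (*)" "one (subalgebra_ring n U) = 1"
  "zero (subalgebra_ring n U) = 0" "add (subalgebra_ring n U) = (+)"
  by (simp_all add: subalgebra_ring_def)

lemma mem_mpoly_ring: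
  "p \<in> carrier (mpoly_ring n) \<longleftrightarrow> (\<forall>m \<in> Poly_Mapping.keys p. Poly_Mapping.keys m \<subseteq> {1..n})"
  by (simp add: mpoly_ring_def)

lemma mem_poly_ring_over:
  "p \<in> carrier (poly_ring_over n) \<longleftrightarrow> (\<forall>i. Polynomial.coeff p i \<in> carrier (mpoly_ring n))"
  by (simp add: poly_ring_over_def)

lemma keys_uminus_mpoly: "Poly_Mapping.keys (- p :: 'k::field mpoly) = Poly_Mapping.keys p"
  by (auto simp: in_keys_iff)

lemma mpoly_closed:
  fixes p q :: "'k::field mpoly"
  shows "0 \<in> carrier (mpoly_ring n :: 'k mpoly ring)" "1 \<in> carrier (mpoly_ring n :: 'k mpoly ring)"
    and "p \<in> carrier (mpoly_ring n) \<Longrightarrow> - p \<in> carrier (mpoly_ring n)"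
    and "p \<in> carrier (mpoly_ring n) \<Longrightarrow> q \<in> carrier (mpoly_ring n) \<Longrightarrow> p + q \<in> carrier (mpoly_ring n)"
    and "p \<in> carrier (mpoly_ring n) \<Longrightarrow> q \<in> carrier (mpoly_ring n) \<Longrightarrow> p * q \<in> carrier (mpoly_ring n)"
proof -
  show "0 \<in> carrier (mpoly_ring n :: 'k mpoly ring)" "1 \<in> carrier (mpoly_ring n :: 'k mpoly ring)"
    by (simp_all add: mem_mpoly_ring)
  show "p \<in> carrier (mpoly_ring n) \<Longrightarrow> - p \<in> carrier (mpoly_ring n)"
    by (simp add: mem_mpoly_ring keys_uminus_mpoly)
  assume p: "p \<in> carrier (mpoly_ring n)" and q: "q \<in> carrier (mpoly_ring n)"
  show "p + q \<in> carrier (mpoly_ring n)"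
    using p q Poly_Mapping.keys_add[of p q] by (fastforce simp: mem_mpoly_ring)
  show "p * q \<in> carrier (mpoly_ring n)"
    unfolding mem_mpoly_ring
  proof
    fix m assume "m \<in> Poly_Mapping.keys (p * q)"
    then obtain a b where ab: "m = a + b" "a \<in> Poly_Mapping.keys p" "b \<in> Poly_Mapping.keys q"
      using Poly_Mapping.keys_mult[of p q] by auto
    then have "Poly_Mapping.keys a \<subseteq> {1..n}" "Poly_Mapping.keys b \<subseteq> {1..n}"
      using p q by (auto simp: mem_mpoly_ring)
    then show "Poly_Mapping.keys m \<subseteq> {1..n}"
      using Poly_Mapping.keys_add[of a b] ab(1) by blast
  qed
qed

lemma mpoly_sum_closed:
  "(\<And>i. i \<in> A \<Longrightarrow> f i \<in> carrier (mpoly_ring n)) \<Longrightarrow> sum f A \<in> carrier (mpoly_ring n)"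
  by (induction A rule: infinite_finite_induct) (auto intro: mpoly_closed)

lemma mpoly_prod_closed:
  "(\<And>i. i \<in> A \<Longrightarrow> f i \<in> carrier (mpoly_ring n)) \<Longrightarrow> prod f A \<in> carrier (mpoly_ring n)"
  by (induction A rule: infinite_finite_induct) (auto intro: mpoly_closed)

lemma mconst_closed: "mconst c \<in> carrier (mpoly_ring n)"
  by (simp add: mem_mpoly_ring mconst_def)

lemma mvar_closed: "i \<in> {1..n} \<Longrightarrow> mvar i \<in> carrier (mpoly_ring n)"
  by (simp add: mem_mpoly_ring mvar_def)

lemma path_gen_closed:
  assumes "n > 0"
  shows "path_gen n t j \<in> carrier (mpoly_ring n)"
  unfolding path_gen_def
proof (intro mpoly_prod_closed mvar_closed)
  fix k
  show "cyc n (j + k) \<in> {1..n}"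
    using assms by (auto simp: cyc_def Suc_le_eq dvd_eq_mod_eq_0 intro: less_imp_le)
qed

lemma cring_mpoly_ring: "cring (mpoly_ring n :: 'k::field mpoly ring)"
proof (rule cringI)
  show "abelian_group (mpoly_ring n :: 'k mpoly ring)"
  proof (rule abelian_groupI)
    fix x :: "'k mpoly" assume "x \<in> carrier (mpoly_ring n)"
    then show "\<exists>y \<in> carrier (mpoly_ring n). y \<oplus>\<^bsub>mpoly_ring n\<^esub> x = \<zero>\<^bsub>mpoly_ring n\<^esub>"
      by (intro bexI[of _ "- x"]) (auto intro: mpoly_closed)
  qed (auto intro: mpoly_closed simp: algebra_simps)
  show "comm_monoid (mpoly_ring n :: 'k mpoly ring)"
    by (rule comm_monoidI) (auto intro: mpoly_closed simp: algebra_simps)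
qed (auto simp: algebra_simps)

lemma cring_poly_ring_over: "cring (poly_ring_over n :: 'k::field mpoly poly ring)"
proof (rule cringI)
  note [intro] = mpoly_closed mpoly_sum_closed
  show "abelian_group (poly_ring_over n :: 'k mpoly poly ring)"
  proof (rule abelian_groupI)
    fix x :: "'k mpoly poly" assume "x \<in> carrier (poly_ring_over n)"
    then show "\<exists>y \<in> carrier (poly_ring_over n). y \<oplus>\<^bsub>poly_ring_over n\<^esub> x = \<zero>\<^bsub>poly_ring_over n\<^esub>"
      by (intro bexI[of _ "- x"]) (auto simp: mem_poly_ring_over)
  qed (auto simp: mem_poly_ring_over algebra_simps)
  show "comm_monoid (poly_ring_over n :: 'k mpoly poly ring)"
  proof (rule comm_monoidI)
    show "\<one>\<^bsub>poly_ring_over n\<^esub> \<in> carrier (poly_ring_over n :: 'k mpoly poly ring)"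
      by (auto simp: mem_poly_ring_over coeff_1)
  qed (auto simp: mem_poly_ring_over coeff_mult algebra_simps)
qed (auto simp: algebra_simps)

lemma rees_generators_closed:
  assumes "U \<subseteq> carrier (mpoly_ring n)"
  shows "(\<lambda>a. [:a:]) ` carrier (mpoly_ring n) \<union> (\<lambda>u. [:0, u:]) ` U
           \<subseteq> carrier (poly_ring_over n :: 'k::field mpoly poly ring)"
  using assms by (auto simp: mem_poly_ring_over coeff_pCons mpoly_closed split: nat.split)

lemma cring_rees_algebra:
  assumes "U \<subseteq> carrier (mpoly_ring n)"
  shows "cring (rees_algebra n U)"
proof -
  interpret cring "poly_ring_over n" by (rule cring_poly_ring_over)
  show ?thesis
    unfolding rees_algebra_def
    by (intro subcring_iff[THEN iffD1] generate_ring_incl subcringI' generate_ring_is_subring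
        rees_generators_closed assms)
qed

lemma cring_subalgebra_ring:
  assumes "U \<subseteq> carrier (mpoly_ring n)"
  shows "cring (subalgebra_ring n U)"
proof -
  interpret cring "mpoly_ring n" by (rule cring_mpoly_ring)
  have "range mconst \<union> U \<subseteq> carrier (mpoly_ring n)"
    using assms by (auto intro: mconst_closed)
  then show ?thesis
    unfolding subalgebra_ring_def
    by (intro subcring_iff[THEN iffD1] generate_ring_incl subcringI' generate_ring_is_subring)
qed

lemma mem_rees_algebra:
  "x \<in> carrier (rees_algebra n U) \<longleftrightarrow> x \<in> generate_ring (poly_ring_over n)
     ((\<lambda>a. [:a:]) ` carrier (mpoly_ring n) \<union> (\<lambda>u. [:0, u:]) ` U)"
  by (simp add: rees_algebra_def)

lemma rees_algebra_genideal:
  fixes U :: "'k::field mpoly set"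
  assumes U: "U \<subseteq> carrier (mpoly_ring n)"
  shows "rees_algebra n (Idl\<^bsub>mpoly_ring n\<^esub> U) = rees_algebra n U"
proof -
  interpret S: cring "mpoly_ring n" by (rule cring_mpoly_ring)
  interpret P: cring "poly_ring_over n" by (rule cring_poly_ring_over)
  interpret Q: cring "rees_algebra n U" by (rule cring_rees_algebra[OF U])
  let ?I = "Idl\<^bsub>mpoly_ring n\<^esub> U"
  let ?C = "(\<lambda>a. [:a:]) ` carrier (mpoly_ring n)"
  let ?G = "\<lambda>V. generate_ring (poly_ring_over n) (?C \<union> (\<lambda>u. [:0, u:]) ` V)"
  have I: "ideal ?I (mpoly_ring n)" by (rule S.genideal_ideal[OF U])
  have UI: "U \<subseteq> ?I" by (rule S.genideal_self[OF U])
  have IS: "?I \<subseteq> carrier (mpoly_ring n)"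
    using I by (meson additive_subgroup.a_subset ideal.axioms(1))
  have C: "[:a:] \<in> carrier (rees_algebra n U)" if "a \<in> carrier (mpoly_ring n)" for a
    using that by (auto simp: mem_rees_algebra intro: generate_ring.incl)
  define J where "J = {a \<in> carrier (mpoly_ring n). [:0, a:] \<in> carrier (rees_algebra n U)}"
  have "ideal J (mpoly_ring n)"
  proof (rule idealI)
    show "ring (mpoly_ring n)" by (rule S.ring_axioms)
    show "subgroup J (add_monoid (mpoly_ring n))"
    proof (rule S.add.subgroupI)
      show "J \<subseteq> carrier (mpoly_ring n)" by (auto simp: J_def)
      show "J \<noteq> {}" using C[of 0] Q.zero_closed by (auto simp: J_def mpoly_closed intro!: exI[of _ 0])
    next
      fix a assume a: "a \<in> J"
      have "\<ominus>\<^bsub>mpoly_ring n\<^esub> a = - a"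
        using a by (intro S.minus_equality) (auto simp: J_def mpoly_closed)
      moreover have "[:- 1:] * [:0, a:] \<in> carrier (rees_algebra n U)"
        using a C[of "- 1"] Q.m_closed[of "[:- 1:]" "[:0, a:]"] by (auto simp: J_def mpoly_closed)
      ultimately show "\<ominus>\<^bsub>mpoly_ring n\<^esub> a \<in> J"
        using a by (auto simp: J_def mpoly_closed)
    next
      fix a b assume "a \<in> J" "b \<in> J"
      then show "a \<oplus>\<^bsub>mpoly_ring n\<^esub> b \<in> J"
        using Q.a_closed[of "[:0, a:]" "[:0, b:]"] by (auto simp: J_def mpoly_closed)
    qed
  next
    fix a x :: "'k mpoly" assume ax: "a \<in> J" "x \<in> carrier (mpoly_ring n)"
    then have "[:x:] * [:0, a:] \<in> carrier (rees_algebra n U)"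
      using C[of x] Q.m_closed[of "[:x:]" "[:0, a:]"] by (auto simp: J_def)
    then show "x \<otimes>\<^bsub>mpoly_ring n\<^esub> a \<in> J"
      using ax by (simp add: J_def mpoly_closed mult.commute)
    then show "a \<otimes>\<^bsub>mpoly_ring n\<^esub> x \<in> J"
      by (simp add: mult.commute)
  qed
  moreover have "U \<subseteq> J"
    using U by (auto simp: J_def mem_rees_algebra intro: generate_ring.incl)
  ultimately have "?I \<subseteq> J" by (rule S.genideal_minimal)
  then have "?C \<union> (\<lambda>u. [:0, u:]) ` ?I \<subseteq> ?G U"
    by (auto simp: J_def mem_rees_algebra intro: generate_ring.incl)
  then have "?G ?I \<subseteq> ?G U"
    by (intro P.generate_ring_min_subring1 P.generate_ring_is_subring rees_generators_closed U IS)
  moreover have "?G U \<subseteq> ?G ?I"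
    using UI by (intro P.mono_generate_ring Un_mono image_mono subset_refl rees_generators_closed IS)
  ultimately have "?G ?I = ?G U" by blast
  then show ?thesis
    by (simp add: rees_algebra_def)
qed

lemma mconst_simps [simp]:
  "mconst 0 = 0" "mconst 1 = (1 :: 'k::field mpoly)"
  by (simp_all add: mconst_def)

lemma mconst_add: "mconst (a + b) = mconst a + (mconst b :: 'k::field mpoly)"
  and mconst_mult: "mconst (a * b) = mconst a * (mconst b :: 'k::field mpoly)"
  by (simp_all add: mconst_def single_add mult_single)

text \<open>
  \<open>mpoly_subst\<close> is the substitution homomorphism, so \<open>fiber_map\<close> and \<open>path_map\<close> are ring
  homomorphisms with the prescribed values on constants and variables.
\<close>

lemma mpoly_subst_single:
  "h 0 = 0 \<Longrightarrow> mpoly_subst h g (Poly_Mapping.single m c) =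
     h c * (\<Prod>i \<in> Poly_Mapping.keys m. g i ^ Poly_Mapping.lookup m i)"
  by (simp add: mpoly_subst_def)

lemma mpoly_subst_mconst: "h 0 = 0 \<Longrightarrow> mpoly_subst h g (mconst c) = h c"
  by (simp add: mconst_def mpoly_subst_single)

lemma mpoly_subst_mvar: "h 0 = 0 \<Longrightarrow> h 1 = 1 \<Longrightarrow> mpoly_subst h g (mvar i) = g i"
  by (simp add: mvar_def mpoly_subst_single)

lemma mpoly_subst_one: "h 0 = 0 \<Longrightarrow> h 1 = 1 \<Longrightarrow> mpoly_subst h g 1 = 1"
  by (simp add: mpoly_subst_def)

lemma mpoly_subst_add:
  assumes "h 0 = 0" "\<And>a b. h (a + b) = h a + h b"
  shows "mpoly_subst h g (p + q) = mpoly_subst h g p + mpoly_subst h g q"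
  unfolding mpoly_subst_def
  by (rule setsum_keys_plus_distrib) (auto simp: assms algebra_simps)

lemma mpoly_subst_sum:
  assumes "h 0 = 0" "\<And>a b. h (a + b) = h a + h b"
  shows "mpoly_subst h g (sum f A) = (\<Sum>i\<in>A. mpoly_subst h g (f i))"
proof (induction A rule: infinite_finite_induct)
  case (insert x A)
  then show ?case by (simp add: mpoly_subst_add[of h, OF assms])
qed (auto simp: mpoly_subst_def)

lemma prod_lookup_add:
  fixes g :: "nat \<Rightarrow> 'b::comm_semiring_1" and k l :: "nat \<Rightarrow>\<^sub>0 nat"
  shows "(\<Prod>i \<in> Poly_Mapping.keys (k + l). g i ^ Poly_Mapping.lookup (k + l) i) =
     (\<Prod>i \<in> Poly_Mapping.keys k. g i ^ Poly_Mapping.lookup k i) *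
     (\<Prod>i \<in> Poly_Mapping.keys l. g i ^ Poly_Mapping.lookup l i)"
proof -
  let ?A = "Poly_Mapping.keys k \<union> Poly_Mapping.keys l"
  have *: "(\<Prod>i \<in> Poly_Mapping.keys m. g i ^ Poly_Mapping.lookup m i) =
           (\<Prod>i \<in> ?A. g i ^ Poly_Mapping.lookup m i)" if "Poly_Mapping.keys m \<subseteq> ?A" for m
    using that by (intro prod.mono_neutral_left) (auto simp: in_keys_iff)
  show ?thesis
    unfolding *[of k, OF Un_upper1] *[of l, OF Un_upper2] *[of "k + l", OF Poly_Mapping.keys_add]
    by (simp add: prod.distrib[symmetric] lookup_add power_add)
qed

lemma mpoly_expand:
  "p = (\<Sum>m \<in> Poly_Mapping.keys p. Poly_Mapping.single m (Poly_Mapping.lookup p m))"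
proof (rule poly_mapping_eqI)
  fix k
  have "(\<Sum>m \<in> Poly_Mapping.keys p. (Poly_Mapping.lookup p m when m = k)) =
        (\<Sum>m \<in> Poly_Mapping.keys p. if m = k then Poly_Mapping.lookup p k else 0)"
    by (intro sum.cong) (auto simp: when_def)
  also have "\<dots> = Poly_Mapping.lookup p k"
    by (auto simp: sum.delta in_keys_iff)
  finally show "Poly_Mapping.lookup p k = Poly_Mapping.lookup
      (\<Sum>m \<in> Poly_Mapping.keys p. Poly_Mapping.single m (Poly_Mapping.lookup p m)) k"
    by (simp add: lookup_sum lookup_single)
qed

lemma mpoly_subst_mult:
  fixes h :: "'k::comm_semiring_1 \<Rightarrow> 'b::comm_semiring_1"
  assumes h: "h 0 = 0" "\<And>a b. h (a + b) = h a + h b" and mult: "\<And>a b. h (a * b) = h a * h b"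
  shows "mpoly_subst h g (p * q) = mpoly_subst h g p * mpoly_subst h g q"
proof -
  let ?s = "\<lambda>p m. Poly_Mapping.single m (Poly_Mapping.lookup p m)"
  have "p * q = (\<Sum>k \<in> Poly_Mapping.keys p. \<Sum>l \<in> Poly_Mapping.keys q. ?s p k * ?s q l)"
    by (rule trans[OF arg_cong2[of _ _ _ _ "(*)", OF mpoly_expand mpoly_expand] sum_product])
  then have "mpoly_subst h g (p * q) = (\<Sum>k \<in> Poly_Mapping.keys p. \<Sum>l \<in> Poly_Mapping.keys q.
      mpoly_subst h g (?s p k * ?s q l))"
    by (simp only: mpoly_subst_sum[of h, OF h])
  also have "\<dots> = mpoly_subst h g p * mpoly_subst h g q"
    unfolding mpoly_subst_def[of h g p] mpoly_subst_def[of h g q] sum_product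
    by (intro sum.cong refl)
       (simp add: mult_single mpoly_subst_single[of h, OF h(1)] prod_lookup_add mult ac_simps)
  finally show ?thesis .
qed

lemma closed_sum:
  assumes "0 \<in> C" "\<And>a b. a \<in> C \<Longrightarrow> b \<in> C \<Longrightarrow> a + b \<in> C" "\<And>x. x \<in> B \<Longrightarrow> f x \<in> C"
  shows "sum f B \<in> C"
  using assms(3) by (induction B rule: infinite_finite_induct) (simp_all add: assms(1,2))

lemma closed_prod:
  fixes f :: "'i \<Rightarrow> 'b::comm_semiring_1"
  assumes "1 \<in> C" "\<And>a b. a \<in> C \<Longrightarrow> b \<in> C \<Longrightarrow> a * b \<in> C" "\<And>x. x \<in> B \<Longrightarrow> f x \<in> C"
  shows "prod f B \<in> C"
  using assms(3) by (induction B rule: infinite_finite_induct) (simp_all add: assms(1,2))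

lemma mpoly_subst_closed:
  assumes "cring A" "monoid.mult A = (*)" "one A = 1" "zero A = 0" "add A = (+)"
    and h: "\<And>c. h c \<in> carrier A" and g: "\<And>i. i \<in> {1..n} \<Longrightarrow> g i \<in> carrier A"
    and p: "p \<in> carrier (mpoly_ring n)"
  shows "mpoly_subst h g p \<in> carrier A"
proof -
  interpret cring A by fact
  note A = assms(2-5)
  have add: "a + b \<in> carrier A" and mul: "a * b \<in> carrier A"
    if "a \<in> carrier A" "b \<in> carrier A" for a b
    using that a_closed[of a b] m_closed[of a b] by (simp_all add: A)
  have 0: "0 \<in> carrier A" and 1: "1 \<in> carrier A"
    using zero_closed one_closed by (simp_all add: A)
  have pow: "a ^ k \<in> carrier A" if "a \<in> carrier A" for a and k :: nat
    by (induction k) (auto intro: that mul 1)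
  have "g i \<in> carrier A" if "m \<in> Poly_Mapping.keys p" "i \<in> Poly_Mapping.keys m" for m i
    by (rule g[OF subsetD[OF bspec[OF p[unfolded mem_mpoly_ring] that(1)] that(2)]])
  then show ?thesis
    unfolding mpoly_subst_def
    by (intro closed_sum closed_prod 0 1 add mul h pow)
qed

lemma path_gens_closed: "path_gens n t \<subseteq> carrier (mpoly_ring n)"
  unfolding path_gens_def by (intro image_subsetI path_gen_closed) simp

lemma path_map_mconst: "path_map n t (mconst c) = mconst c"
  and path_map_mvar: "path_map n t (mvar i) = path_gen n t i"
  by (simp_all add: path_map_def mpoly_subst_mconst mpoly_subst_mvar)

lemma path_map_hom:
  "(path_map n t :: 'k::field mpoly \<Rightarrow> _) \<in> ring_hom (mpoly_ring n) (subalgebra_ring n (path_gens n t))"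
proof (rule ring_hom_memI)
  fix p :: "'k mpoly" assume "p \<in> carrier (mpoly_ring n)"
  then show "path_map n t p \<in> carrier (subalgebra_ring n (path_gens n t))"
    unfolding path_map_def
    by (intro mpoly_subst_closed[where n = n] cring_subalgebra_ring path_gens_closed)
       (auto simp: subalgebra_ring_def path_gens_def intro: generate_ring.incl)
next
  fix p q :: "'k mpoly"
  show "path_map n t (p \<otimes>\<^bsub>mpoly_ring n\<^esub> q) =
      path_map n t p \<otimes>\<^bsub>subalgebra_ring n (path_gens n t)\<^esub> path_map n t q"
    by (simp add: path_map_def mpoly_subst_mult mconst_add mconst_mult)
  show "path_map n t (p \<oplus>\<^bsub>mpoly_ring n\<^esub> q) =
      path_map n t p \<oplus>\<^bsub>subalgebra_ring n (path_gens n t)\<^esub> path_map n t q"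
    by (simp add: path_map_def mpoly_subst_add mconst_add)
next
  show "path_map n t \<one>\<^bsub>mpoly_ring n\<^esub> = \<one>\<^bsub>subalgebra_ring n (path_gens n t)\<^esub>"
    by (simp add: path_map_def mpoly_subst_one)
qed

lemma rees_max_ideal_ideal:
  "ideal (rees_max_ideal n (path_gens n t)) (rees_algebra n (path_gens n t))"
proof -
  interpret S: cring "mpoly_ring n" by (rule cring_mpoly_ring)
  interpret Q: cring "rees_algebra n (path_gens n t)"
    by (rule cring_rees_algebra[OF path_gens_closed])
  have "ideal (max_ideal n) (mpoly_ring n)"
    unfolding max_ideal_def by (intro S.genideal_ideal) (auto intro: mvar_closed)
  then have "max_ideal n \<subseteq> carrier (mpoly_ring n)"
    by (meson additive_subgroup.a_subset ideal.axioms(1))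
  moreover have "[:a:] \<in> carrier (rees_algebra n (path_gens n t))"
    if "a \<in> carrier (mpoly_ring n)" for a :: "'a mpoly"
    using that by (auto simp: mem_rees_algebra intro: generate_ring.incl)
  ultimately show ?thesis
    unfolding rees_max_ideal_def
    by (intro Q.genideal_ideal) (blast)
qed

lemma fiber_map_mconst:
  "fiber_map n t (mconst c) =
     rees_max_ideal n (path_gens n t) +>\<^bsub>rees_algebra n (path_gens n t)\<^esub> [:mconst c:]"
  unfolding fiber_map_def by (subst mpoly_subst_mconst) simp_all

lemma fiber_map_mvar:
  "fiber_map n t (mvar i :: 'k::field mpoly) =
     rees_max_ideal n (path_gens n t) +>\<^bsub>rees_algebra n (path_gens n t)\<^esub> [:0, path_gen n t i:]"
  unfolding fiber_map_def by (subst mpoly_subst_mvar) (simp_all add: one_pCons[symmetric])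

lemma fiber_map_hom:
  "(fiber_map n t :: 'k::field mpoly \<Rightarrow> _) \<in> ring_hom (mpoly_ring n) (fiber_cone n (path_gens n t))"
proof -
  let ?R = "rees_algebra n (path_gens n t) :: 'k mpoly poly ring"
  let ?e = "mpoly_subst (\<lambda>c. [:mconst c:]) (\<lambda>i. [:0, path_gen n t i:])"
  interpret I: ideal "rees_max_ideal n (path_gens n t)" ?R
    by (rule rees_max_ideal_ideal)
  have e: "?e \<in> ring_hom (mpoly_ring n) ?R"
  proof (rule ring_hom_memI)
    fix p :: "'k mpoly" assume "p \<in> carrier (mpoly_ring n)"
    then show "?e p \<in> carrier ?R"
      by (intro mpoly_subst_closed[where n = n] cring_rees_algebra path_gens_closed)
         (auto simp: mem_rees_algebra path_gens_def intro: generate_ring.incl mconst_closed)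
    fix q :: "'k mpoly"
    show "?e (p \<otimes>\<^bsub>mpoly_ring n\<^esub> q) = ?e p \<otimes>\<^bsub>?R\<^esub> ?e q"
      by (simp add: mpoly_subst_mult mconst_add mconst_mult)
    show "?e (p \<oplus>\<^bsub>mpoly_ring n\<^esub> q) = ?e p \<oplus>\<^bsub>?R\<^esub> ?e q"
      by (simp add: mpoly_subst_add mconst_add)
  next
    show "?e \<one>\<^bsub>mpoly_ring n\<^esub> = \<one>\<^bsub>?R\<^esub>"
      by (simp add: mpoly_subst_one one_pCons[symmetric])
  qed
  have "(\<lambda>p. rees_max_ideal n (path_gens n t) +>\<^bsub>?R\<^esub> ?e p) \<in>
      ring_hom (mpoly_ring n) (fiber_cone n (path_gens n t))"
    using ring_hom_trans[OF e I.rcos_ring_hom] by (simp only: fiber_cone_def comp_def)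
  then show ?thesis
    by (simp only: fiber_map_def[abs_def])
qed

end

theory Submission
  imports Defs
begin

text \<open>
  Both kernels are computed by reducing the fiber cone to \<open>K[u\<^sub>1, \<dots>, u\<^sub>n]\<close>, which is a toric ring.

  The map \<open>path_map\<close> sends the monomial \<open>y\<^sup>a\<close> to a monomial in which the exponent of
  \<open>x\<^sub>j\<close> is the sum of the entries of \<open>a\<close> over the cyclic window of length \<open>t\<close> ending at
  \<open>j\<close>. Its kernel is therefore spanned by the binomials \<open>y\<^sup>a - y\<^sup>b\<close> such that \<open>a\<close> and \<open>b\<close>
  have the same window sums (\<open>path_map_kernel_in_ideal\<close>). For such a pair the difference
  \<open>c = a - b\<close> has vanishing window sums. Subtracting two adjacent windows gives
  \<open>c(j + t) = c(j)\<close>; as \<open>c\<close> also has period \<open>n\<close>, it has period \<open>d = gcd n t\<close>, and since a window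
  consists of \<open>t/d\<close> full periods, \<open>c\<close> sums to zero over one period (\<open>zero_window_sums\<close>). Cancelling
  the common factor of \<open>y\<^sup>a\<close> and \<open>y\<^sup>b\<close> leaves the monomials with exponents \<open>max(c, 0)\<close> and
  \<open>max(-c, 0)\<close>. These exponents are constant on residue classes modulo \<open>d\<close>, so both monomials are
  products of the \<open>m\<^sub>i\<close>, with equally many factors. Modulo the ideal \<open>H'\<close> every \<open>m\<^sub>i\<close> becomes
  \<open>m\<^sub>d\<close>, hence the two monomials agree (\<open>binomial_relation\<close>). Conversely all \<open>m\<^sub>i\<close> have the same
  image (\<open>path_map_residue_monom\<close>).

  For the fiber cone, lift \<open>y\<^sub>i\<close> to \<open>u\<^sub>i s\<close> in the Rees algebra. In the Rees algebra the coefficient of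
  \<open>s\<^sup>k\<close> involves only monomials of degree at least \<open>t k\<close>, and in the ideal generated by
  the variables only monomials of degree at least \<open>t k + 1\<close>. The lift of any polynomial, however, has
  degree exactly \<open>t k\<close> there, so it lies in that ideal only if it is zero
  (\<open>rees_lift_in_rees_max_ideal_iff\<close>). Putting \<open>s = 1\<close> turns the lift into \<open>path_map\<close>, without
  cancellation between different powers of \<open>s\<close>, because their coefficients have different degrees
  (\<open>rees_lift_eq_0_iff\<close>). Hence both maps have the same kernel.
\<close>

section \<open>Cyclic indices and periodic functions\<close>

lemma cyc_in: "n > 0 \<Longrightarrow> cyc n i \<in> {1..n}"
  by (auto simp: cyc_def Suc_le_eq dvd_eq_mod_eq_0 intro: less_imp_le)

lemma cyc_mod: "cyc n i mod n = i mod n"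
  by (auto simp: cyc_def)

lemma cyc_eq_iff: "cyc n i = cyc n j \<longleftrightarrow> [i = j] (mod n)"
proof
  show "[i = j] (mod n)" if "cyc n i = cyc n j"
    using arg_cong[OF that, of "\<lambda>x. x mod n"] by (simp add: cyc_mod cong_def)
qed (simp add: cyc_def cong_def dvd_eq_mod_eq_0)

lemma cyc_ident: "i \<in> {1..n} \<Longrightarrow> cyc n i = i"
  by (auto simp: cyc_def le_less dest: dvd_imp_le)

lemma cyc_cong_dvd: "d dvd n \<Longrightarrow> [cyc n x = x] (mod d)"
  using cyc_mod[of n x] by (metis cong_def mod_mod_cancel)

lemma cyc_cyc_add: "cyc n (cyc n x + y) = cyc n (x + y)"
  unfolding cyc_eq_iff by (metis cyc_mod cong_def mod_add_left_eq)

lemma periodic_cong: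
  fixes c :: "nat \<Rightarrow> 'a"
  assumes per: "\<And>x. c (x + d) = c x" and "[x = y] (mod d)"
  shows "c x = c y"
proof -
  have *: "c (x + k * d) = c x" for x k
  proof (induction k)
    case (Suc k)
    then show ?case using per[of "x + k * d"] by (simp add: ac_simps)
  qed simp
  have "c z = c (z mod d)" for z
    using *[of "z mod d" "z div d"] by simp
  then show ?thesis
    using assms(2) by (metis cong_def)
qed

text \<open>
  Two adjacent windows differ by \<open>c (x + t) - c x\<close>, so \<open>c\<close> has the periods \<open>n\<close> and \<open>t\<close> and, by
  Bezout, the period \<open>gcd n t\<close>. A window is a whole number of these periods.
\<close>

lemma zero_window_sums:
  fixes c :: "nat \<Rightarrow> int"
  assumes per: "\<And>x. c (x + n) = c x" and win: "\<And>x. (\<Sum>k<t. c (x + k)) = 0" and t: "t > 0"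
  shows "c (x + gcd n t) = c x" and "(\<Sum>k<gcd n t. c k) = 0"
proof -
  have pt: "c (x + t) = c x" for x
  proof -
    have "(\<Sum>k<Suc t. c (x + k)) = c (x + t)"
      using win[of x] by simp
    moreover have "(\<Sum>k<Suc t. c (x + k)) = c x"
      using win[of "Suc x"] by (simp add: sum.lessThan_Suc_shift del: sum.lessThan_Suc)
    ultimately show ?thesis by simp
  qed
  have pd: "c (x + gcd n t) = c x" for x
  proof -
    obtain a b where ab: "t * a = n * b + gcd t n"
      using bezout_nat[of t n] t by auto
    have "c (x + gcd n t) = c (x + gcd n t + n * b)"
      by (rule periodic_cong[of c n, OF per]) (simp add: cong_def)
    also have "\<dots> = c (x + t * a)"
      using ab by (simp add: gcd.commute[of n t] add.commute add.left_commute)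
    also have "\<dots> = c x"
      by (rule periodic_cong[of c t, OF pt]) (simp add: cong_def)
    finally show ?thesis .
  qed
  then show "c (x + gcd n t) = c x" .
  let ?d = "gcd n t"
  obtain q where q: "t = q * ?d"
    by (metis gcd_dvd2 dvd_def mult.commute)
  have "(\<Sum>k<q * ?d. c k) = (\<Sum>m<q. \<Sum>k\<in>{m * ?d..<m * ?d + ?d}. c k)"
    by (simp add: sum.nat_group)
  also have "\<dots> = (\<Sum>m<q. \<Sum>k<?d. c k)"
  proof (rule sum.cong[OF refl])
    fix m
    have "(\<Sum>k\<in>{m * ?d..<m * ?d + ?d}. c k) = (\<Sum>k<?d. c (m * ?d + k))"
      using sum.shift_bounds_nat_ivl[of c 0 "m * ?d" ?d] by (simp add: lessThan_atLeast0 add.commute)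
    also have "\<dots> = (\<Sum>k<?d. c k)"
      by (intro sum.cong refl periodic_cong[of c ?d, OF pd]) (simp add: cong_def)
    finally show "(\<Sum>k\<in>{m * ?d..<m * ?d + ?d}. c k) = (\<Sum>k<?d. c k)" .
  qed
  finally have "int q * (\<Sum>k<?d. c k) = 0"
    using win[of 0] q by simp
  moreover have "q > 0" using q t by (cases q) auto
  ultimately show "(\<Sum>k<?d. c k) = 0" by simp
qed

section \<open>Monomials and their images\<close>

lemma prod_single_one:
  "(\<Prod>i\<in>A. Poly_Mapping.single (f i) 1) = (Poly_Mapping.single (\<Sum>i\<in>A. f i) 1 :: 'k::field mpoly)"
  by (induction A rule: infinite_finite_induct) (simp_all add: mult_single)

lemma power_single_one:
  "Poly_Mapping.single m 1 ^ k = (Poly_Mapping.single (\<Sum>_<k. m) 1 :: 'k::field mpoly)"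
  using prod_single_one[of "\<lambda>_. m" "{..<k}"] by simp

text \<open>
  The exponent of the image of the monomial with exponent \<open>m\<close>. Multiples are written as iterated
  sums, which is the form in which powers of monomials produce them.
\<close>

definition path_exp :: "nat \<Rightarrow> nat \<Rightarrow> (nat \<Rightarrow>\<^sub>0 nat) \<Rightarrow> (nat \<Rightarrow>\<^sub>0 nat)" where
  "path_exp n t m = (\<Sum>i\<in>Poly_Mapping.keys m. \<Sum>_<Poly_Mapping.lookup m i.
     \<Sum>k<t. Poly_Mapping.single (cyc n (i + k)) 1)"

lemma path_gen_single:
  "path_gen n t j = (Poly_Mapping.single (\<Sum>k<t. Poly_Mapping.single (cyc n (j + k)) 1) 1 :: 'k::field mpoly)"
  by (simp add: path_gen_def mvar_def prod_single_one)

lemma path_map_single: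
  "path_map n t (Poly_Mapping.single m c) = (Poly_Mapping.single (path_exp n t m) c :: 'k::field mpoly)"
  by (simp add: path_map_def mpoly_subst_single path_gen_single power_single_one prod_single_one
      mconst_def mult_single path_exp_def del: sum_constant)

text \<open>
  The variable with index \<open>x + t\<close> occurs in the generators that start at \<open>x + 1, \<dots>, x + t\<close>,
  once in each. Indexing the variable by \<open>x + t\<close> avoids a truncated subtraction at the start of this
  window.
\<close>

lemma lookup_path_exp:
  assumes m: "Poly_Mapping.keys m \<subseteq> {1..n}" and n: "n > 0"
  shows "Poly_Mapping.lookup (path_exp n t m) (cyc n (x + t)) =
    (\<Sum>k<t. Poly_Mapping.lookup m (cyc n (Suc x + k)))"
proof -
  let ?a = "Poly_Mapping.lookup m"
  have "Poly_Mapping.lookup (path_exp n t m) (cyc n (x + t)) =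
      (\<Sum>i\<in>Poly_Mapping.keys m. \<Sum>k<t. if cyc n (i + k) = cyc n (x + t) then ?a i else 0)"
    by (simp add: path_exp_def lookup_sum lookup_single when_def sum_distrib_left if_distrib del: sum_constant
         cong: if_cong) (simp add: sum_distrib_left if_distrib cong: if_cong)
  also have "\<dots> = (\<Sum>i\<in>{1..n}. \<Sum>k<t. if cyc n (i + k) = cyc n (x + t) then ?a i else 0)"
    using m by (intro sum.mono_neutral_left) (auto simp: in_keys_iff)
  also have "\<dots> = (\<Sum>k<t. \<Sum>i\<in>{1..n}. if cyc n (i + k) = cyc n (x + t) then ?a i else 0)"
    by (rule sum.swap)
  also have "\<dots> = (\<Sum>k<t. ?a (cyc n (x + (t - k))))"
  proof (rule sum.cong[OF refl])
    \<comment> \<open>For a fixed offset \<open>k\<close> exactly one generator has \<open>x + t\<close> as its \<open>k\<close>-th index.\<close>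
    fix k assume k: "k \<in> {..<t}"
    have "cyc n (i + k) = cyc n (x + t) \<longleftrightarrow> cyc n (x + (t - k)) = i" if "i \<in> {1..n}" for i
    proof -
      have "cyc n (i + k) = cyc n (x + t) \<longleftrightarrow> [i + k = (x + (t - k)) + k] (mod n)"
        using k by (simp add: cyc_eq_iff)
      also have "\<dots> \<longleftrightarrow> cyc n i = cyc n (x + (t - k))"
        unfolding cyc_eq_iff by (rule cong_add_rcancel_nat)
      finally show ?thesis using cyc_ident[OF that] by auto
    qed
    then have "(\<Sum>i\<in>{1..n}. if cyc n (i + k) = cyc n (x + t) then ?a i else 0) =
        (\<Sum>i\<in>{1..n}. if cyc n (x + (t - k)) = i then ?a i else 0)"
      by (intro sum.cong) auto
    also have "\<dots> = ?a (cyc n (x + (t - k)))"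
      using cyc_in[OF n] by (simp add: sum.delta')
    finally show "(\<Sum>i\<in>{1..n}. if cyc n (i + k) = cyc n (x + t) then ?a i else 0) =
        ?a (cyc n (x + (t - k)))" .
  qed
  also have "\<dots> = (\<Sum>k<t. ?a (cyc n (Suc x + (t - Suc k))))"
    by (intro sum.cong refl arg_cong[where f = ?a] arg_cong[where f = "cyc n"]) auto
  also have "\<dots> = (\<Sum>k<t. ?a (cyc n (Suc x + k)))"
    by (rule sum.nat_diff_reindex)
  finally show ?thesis .
qed

lemma single_eq_prod_mvar:
  assumes "Poly_Mapping.keys m \<subseteq> {1..n}"
  shows "(Poly_Mapping.single m 1 :: 'k::field mpoly) = (\<Prod>j\<in>{1..n}. mvar j ^ Poly_Mapping.lookup m j)"
proof -
  have "m = (\<Sum>j\<in>{1..n}. \<Sum>_<Poly_Mapping.lookup m j. Poly_Mapping.single j 1)"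
  proof (rule poly_mapping_eqI)
    fix k
    show "Poly_Mapping.lookup m k =
        Poly_Mapping.lookup (\<Sum>j\<in>{1..n}. \<Sum>_<Poly_Mapping.lookup m j. Poly_Mapping.single j 1) k"
      using assms
      by (auto simp: lookup_sum lookup_single when_def if_distrib sum.delta in_keys_iff
          simp del: sum_constant cong: if_cong)
         (auto simp: if_distrib sum.delta in_keys_iff cong: if_cong)
  qed
  then show ?thesis
    by (simp add: mvar_def power_single_one prod_single_one del: sum_constant)
qed

section \<open>The relations among the generators\<close>

lemma residue_monom_cong: "[i = j] (mod d) \<Longrightarrow> residue_monom n d i = residue_monom n d j"
  unfolding residue_monom_def
  by (intro prod.cong) (auto intro: cong_trans cong_sym)

lemma residue_monom_closed: "residue_monom n d i \<in> carrier (mpoly_ring n)"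
  unfolding residue_monom_def by (intro mpoly_prod_closed mvar_closed) auto

text \<open>
  Rotating the cycle by \<open>k\<close> permutes the residue classes modulo \<open>d\<close>, because \<open>d\<close> divides \<open>n\<close>.
  The rotation is inverted by \<open>n - 1\<close> further rotations by \<open>k\<close>.
\<close>

lemma residue_monom_shift:
  assumes "d dvd n" "n > 0"
  shows "(\<Prod>j | j \<in> {1..n} \<and> [j = i] (mod d). mvar (cyc n (j + k))) =
         (residue_monom n d (i + k) :: 'k::field mpoly)"
  unfolding residue_monom_def
proof (rule prod.reindex_bij_witness[where j = "\<lambda>j. cyc n (j + k)" and i = "\<lambda>j. cyc n (j + (n - 1) * k)"])
  have nk: "k + (n - 1) * k = n * k"
    using assms(2) by (cases n) auto
  fix j
  assume "j \<in> {j \<in> {1..n}. [j = i] (mod d)}"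
  then have j: "j \<in> {1..n}" "[j = i] (mod d)" by auto
  show "cyc n (cyc n (j + k) + (n - 1) * k) = j"
    unfolding cyc_cyc_add add.assoc nk using cyc_ident[OF j(1)] cyc_eq_iff[of n "j + n * k" j]
    by (simp add: cong_def)
  show "cyc n (j + k) \<in> {j \<in> {1..n}. [j = i + k] (mod d)}"
    using cong_trans[OF cyc_cong_dvd[OF assms(1), of "j + k"] cong_add[OF j(2) cong_refl[of k]]] cyc_in[OF assms(2)]
    by auto
next
  have nk: "(n - 1) * k + k = n * k"
    using assms(2) by (cases n) auto
  fix j
  assume "j \<in> {j \<in> {1..n}. [j = i + k] (mod d)}"
  then have j: "j \<in> {1..n}" "[j = i + k] (mod d)" by auto
  show "cyc n (cyc n (j + (n - 1) * k) + k) = j"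
    unfolding cyc_cyc_add add.assoc nk using cyc_ident[OF j(1)] cyc_eq_iff[of n "j + n * k" j]
    by (simp add: cong_def)
  have "[j + (n - 1) * k + k = i + k] (mod d)"
    unfolding add.assoc nk using j(2) assms(1) 
    by (metis cong_def dvd_mult2 mod_add_right_eq mod_0_imp_dvd dvd_imp_mod_0 add_0_right)
  then have "[j + (n - 1) * k = i] (mod d)"
    by (simp add: cong_add_rcancel_nat)
  then show "cyc n (j + (n - 1) * k) \<in> {j \<in> {1..n}. [j = i] (mod d)}"
    using cong_trans[OF cyc_cong_dvd[OF assms(1)]] cyc_in[OF assms(2)] by auto
qed auto

lemma path_map_prod: "path_map n t (\<Prod>i\<in>A. f i) = (\<Prod>i\<in>A. path_map n t (f i :: 'k::field mpoly))"
  by (induction A rule: infinite_finite_induct)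
     (simp_all add: path_map_def mpoly_subst_one mpoly_subst_mult mconst_add mconst_mult)

text \<open>
  The image of \<open>m\<^sub>i\<close> is \<open>m\<^sub>i m\<^sub>i\<^sub>+\<^sub>1 \<dots> m\<^sub>i\<^sub>+\<^sub>t\<^sub>-\<^sub>1\<close> in the variables \<open>x\<close>. Passing from \<open>i\<close> to
  \<open>i + 1\<close> replaces the factor \<open>m\<^sub>i\<close> by \<open>m\<^sub>i\<^sub>+\<^sub>t\<close>, which is the same since \<open>d\<close> divides \<open>t\<close>.
\<close>

lemma path_map_residue_monom:
  assumes "d dvd n" "d dvd t" "n > 0"
  shows "path_map n t (residue_monom n d i) = (path_map n t (residue_monom n d j) :: 'k::field mpoly)"
proof -
  let ?M = "residue_monom n d :: nat \<Rightarrow> 'k mpoly"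
  have eq: "path_map n t (?M i) = (\<Prod>k<t. ?M (i + k))" for i
  proof -
    have "path_map n t (?M i) =
        (\<Prod>j | j \<in> {1..n} \<and> [j = i] (mod d). \<Prod>k<t. mvar (cyc n (j + k)))"
      by (simp add: residue_monom_def path_map_prod path_map_mvar path_gen_def)
    also have "\<dots> = (\<Prod>k<t. ?M (i + k))"
      by (subst prod.swap) (simp only: residue_monom_shift[OF assms(1,3)])
    finally show ?thesis .
  qed
  have "path_map n t (?M (Suc i)) = path_map n t (?M i)" for i
  proof (cases t)
    case 0
    then show ?thesis unfolding eq by simp
  next
    case (Suc s)
    have "[i + t = i] (mod d)"
      using assms(2) by (auto simp: cong_def elim!: dvdE)
    then have "?M (Suc i + s) = ?M i"
      using Suc by (intro residue_monom_cong) simp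
    moreover have "(\<Prod>k<Suc s. ?M (i + k)) = ?M i * (\<Prod>k<s. ?M (Suc i + k))"
      by (subst prod.lessThan_Suc_shift) simp
    ultimately show ?thesis
      unfolding Suc unfolding eq[unfolded Suc] by (simp add: mult.commute)
  qed
  then have "path_map n t (?M i) = path_map n t (?M 0)" for i
    by (induction i) simp_all
  then show ?thesis by metis
qed

lemma mpoly_power_closed: "p \<in> carrier (mpoly_ring n) \<Longrightarrow> p ^ k \<in> carrier (mpoly_ring n)"
  using mpoly_prod_closed[of "{..<k}" "\<lambda>_. p" n] by simp

lemma mpoly_uminus: "p \<in> carrier (mpoly_ring n) \<Longrightarrow> \<ominus>\<^bsub>mpoly_ring n\<^esub> p = - (p :: 'k::field mpoly)"
proof -
  interpret cring "mpoly_ring n :: 'k mpoly ring" by (rule cring_mpoly_ring)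
  show "p \<in> carrier (mpoly_ring n) \<Longrightarrow> \<ominus>\<^bsub>mpoly_ring n\<^esub> p = - p"
    by (intro minus_equality) (auto simp: mpoly_closed)
qed

lemma mpoly_ideal_closed:
  fixes I :: "'k::field mpoly set"
  assumes "ideal I (mpoly_ring n)"
  shows "0 \<in> I" and "p \<in> I \<Longrightarrow> q \<in> I \<Longrightarrow> p + q \<in> I"
    and "p \<in> I \<Longrightarrow> r \<in> carrier (mpoly_ring n) \<Longrightarrow> r * p \<in> I"
    and "p \<in> I \<Longrightarrow> - p \<in> I"
proof -
  interpret ideal I "mpoly_ring n" by fact
  show "0 \<in> I" using additive_subgroup.zero_closed[OF additive_subgroup_axioms] by simp
  show "p \<in> I \<Longrightarrow> q \<in> I \<Longrightarrow> p + q \<in> I" 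
    using additive_subgroup.a_closed[OF additive_subgroup_axioms, of p q] by simp
  show "p \<in> I \<Longrightarrow> r \<in> carrier (mpoly_ring n) \<Longrightarrow> r * p \<in> I" using I_l_closed[of p r] by simp
  show "p \<in> I \<Longrightarrow> - p \<in> I" 
    using additive_subgroup.a_inv_closed[OF additive_subgroup_axioms, of p] Icarr[of p]
    by (simp add: mpoly_uminus)
qed

lemma ideal_prod_diff:
  fixes f g :: "'i \<Rightarrow> 'k::field mpoly"
  assumes I: "ideal I (mpoly_ring n)"
    and f: "\<And>i. i \<in> A \<Longrightarrow> f i \<in> carrier (mpoly_ring n)"
    and g: "\<And>i. i \<in> A \<Longrightarrow> g i \<in> carrier (mpoly_ring n)"
    and "\<And>i. i \<in> A \<Longrightarrow> f i - g i \<in> I"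
  shows "prod f A - prod g A \<in> I"
  using assms(2-)
proof (induction A rule: infinite_finite_induct)
  case (insert x A)
  then have "f x * (prod f A - prod g A) + prod g A * (f x - g x) \<in> I"
    by (intro mpoly_ideal_closed[OF I] mpoly_prod_closed) auto
  then show ?case using insert by (simp add: algebra_simps)
qed (auto intro: mpoly_ideal_closed[OF I])

text \<open>
  If the exponent is constant on residue classes modulo \<open>d\<close>, the monomial is a product of powers of
  the \<open>m\<^sub>i\<close>, each of which may be replaced by \<open>m\<^sub>d\<close>.
\<close>

lemma periodic_monomial_reduces:
  fixes I :: "'k::field mpoly set"
  assumes I: "ideal I (mpoly_ring n)" and d: "d > 0"
    and gens: "\<And>i. i \<in> {1..<d} \<Longrightarrow> residue_monom n d i - residue_monom n d d \<in> I"
    and per: "\<And>j. j \<in> {1..n} \<Longrightarrow> \<alpha> j = \<alpha> (cyc d j)"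
  shows "(\<Prod>j\<in>{1..n}. mvar j ^ \<alpha> j) - residue_monom n d d ^ (\<Sum>i\<in>{1..d}. \<alpha> i) \<in> I"
proof -
  let ?M = "residue_monom n d :: nat \<Rightarrow> 'k mpoly"
  have "(\<Prod>j\<in>{1..n}. mvar j ^ \<alpha> j) =
      (\<Prod>i\<in>{1..d}. \<Prod>j | j \<in> {1..n} \<and> cyc d j = i. mvar j ^ \<alpha> j :: 'k mpoly)"
    using cyc_in[OF d] by (intro prod.group[symmetric]) auto
  also have "\<dots> = (\<Prod>i\<in>{1..d}. ?M i ^ \<alpha> i)"
  proof (rule prod.cong[OF refl])
    fix i assume i: "i \<in> {1..d}"
    have "cyc d j = i \<longleftrightarrow> [j = i] (mod d)" for j
      using cyc_ident[OF i] cyc_eq_iff[of d j i] by simp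
    moreover have "\<alpha> j = \<alpha> i" if "j \<in> {1..n}" "cyc d j = i" for j
      using per[OF that(1)] that(2) by simp
    ultimately have "(\<Prod>j | j \<in> {1..n} \<and> cyc d j = i. mvar j ^ \<alpha> j :: 'k mpoly) =
        (\<Prod>j | j \<in> {1..n} \<and> [j = i] (mod d). mvar j ^ \<alpha> i)"
      by (intro prod.cong) auto
    then show "(\<Prod>j | j \<in> {1..n} \<and> cyc d j = i. mvar j ^ \<alpha> j :: 'k mpoly) = ?M i ^ \<alpha> i"
      by (simp add: residue_monom_def prod_power_distrib)
  qed
  finally have eq: "(\<Prod>j\<in>{1..n}. mvar j ^ \<alpha> j) = (\<Prod>i\<in>{1..d}. ?M i ^ \<alpha> i)" .
  have "?M i ^ k - ?M d ^ k \<in> I" if "i \<in> {1..d}" for i k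
  proof -
    have "?M i - ?M d \<in> I"
      using that gens[of i] mpoly_ideal_closed(1)[OF I] by (cases "i = d") auto
    then have "(\<Prod>_<k. ?M i) - (\<Prod>_<k. ?M d) \<in> I"
      by (intro ideal_prod_diff[OF I] residue_monom_closed)
    then show ?thesis by simp
  qed
  moreover have "?M i ^ k \<in> carrier (mpoly_ring n)" for i k
    by (rule mpoly_power_closed[OF residue_monom_closed])
  ultimately have "(\<Prod>i\<in>{1..d}. ?M i ^ \<alpha> i) - (\<Prod>i\<in>{1..d}. ?M d ^ \<alpha> i) \<in> I"
    by (intro ideal_prod_diff[OF I]) 
  then show ?thesis by (simp only: eq power_sum)
qed

text \<open>
  Equal images mean equal window sums, so \<open>zero_window_sums\<close> applies to the difference of the
  exponents, extended periodically to all indices.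
\<close>

lemma equal_image_periodic:
  fixes a b :: "nat \<Rightarrow>\<^sub>0 nat"
  assumes a: "Poly_Mapping.keys a \<subseteq> {1..n}" and b: "Poly_Mapping.keys b \<subseteq> {1..n}"
    and eq: "path_exp n t a = path_exp n t b" and t: "t > 0" and n: "n > 0"
  defines "c \<equiv> \<lambda>j. int (Poly_Mapping.lookup a (cyc n j)) - int (Poly_Mapping.lookup b (cyc n j))"
  shows "[i = j] (mod gcd n t) \<Longrightarrow> c i = c j"
    and "(\<Sum>i\<in>{1..gcd n t}. c i) = 0"
proof -
  \<comment> \<open>The vertices are numbered from 1, whereas \<open>zero_window_sums\<close> sums over a period starting at 0.\<close>
  let ?c = "\<lambda>x. c (Suc x)"
  have per: "?c (x + n) = ?c x" for x
  proof -
    have "cyc n (Suc (x + n)) = cyc n (Suc x)" by (simp add: cyc_eq_iff cong_def flip: add_Suc)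
    then show ?thesis by (simp add: c_def)
  qed
  have win: "(\<Sum>k<t. ?c (x + k)) = 0" for x
    using arg_cong[OF eq, of "\<lambda>e. int (Poly_Mapping.lookup e (cyc n (x + t)))"]
    by (simp add: lookup_path_exp[OF a n] lookup_path_exp[OF b n] c_def sum_subtractf)
  note z = zero_window_sums[of ?c, OF per win t]
  show "(\<Sum>i\<in>{1..gcd n t}. c i) = 0"
    using z(2) by (simp add: sum.atLeast1_atMost_eq)
  assume ij: "[i = j] (mod gcd n t)"
  \<comment> \<open>Going once around the cycle expresses \<open>c x\<close> through the shifted function also for \<open>x = 0\<close>.\<close>
  have c: "c x = ?c (x + n - 1)" for x
  proof -
    have "cyc n (x + n) = cyc n x" by (simp add: cyc_eq_iff cong_def)
    then show ?thesis using n by (simp add: c_def)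
  qed
  have "[i + (n - 1) = j + (n - 1)] (mod gcd n t)"
    using ij by (simp add: cong_add_rcancel_nat)
  then have "[i + n - 1 = j + n - 1] (mod gcd n t)"
    using n by simp
  then have "?c (i + n - 1) = ?c (j + n - 1)"
    by (rule periodic_cong[of ?c, OF z(1)])
  then show "c i = c j"
    using c[of i] c[of j] by (simp only:)
qed

text \<open>
  Write \<open>c = a - b\<close>. Then \<open>a = min(a, b) + max(c, 0)\<close> and \<open>b = min(a, b) + max(-c, 0)\<close>, and both
  \<open>max(c, 0)\<close> and \<open>max(-c, 0)\<close> are \<open>d\<close>-periodic. As \<open>c\<close> sums to zero over a period, the two
  remaining monomials reduce to the same power of \<open>m\<^sub>d\<close>.
\<close>

lemma binomial_relation:
  fixes I :: "'k::field mpoly set"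
  assumes I: "ideal I (mpoly_ring n)"
    and gens: "\<And>i. i \<in> {1..<gcd n t} \<Longrightarrow>
                 residue_monom n (gcd n t) i - residue_monom n (gcd n t) (gcd n t) \<in> I"
    and a: "Poly_Mapping.keys a \<subseteq> {1..n}" and b: "Poly_Mapping.keys b \<subseteq> {1..n}"
    and eq: "path_exp n t a = path_exp n t b" and t: "t > 0" and n: "n > 0"
  shows "Poly_Mapping.single a 1 - Poly_Mapping.single b 1 \<in> I"
proof -
  define d where "d = gcd n t"
  have d: "d > 0" "d dvd n" using n by (simp_all add: d_def)
  let ?a = "Poly_Mapping.lookup a" and ?b = "Poly_Mapping.lookup b"
  define c where "c = (\<lambda>j. int (?a (cyc n j)) - int (?b (cyc n j)))"
  have c: "c j = int (?a j) - int (?b j)" if "j \<in> {1..n}" for j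
    using that by (simp add: c_def cyc_ident)
  have cyc: "c j = c (cyc d j)" for j
    unfolding c_def d_def
    by (rule equal_image_periodic(1)[OF a b eq t n]) (simp add: cong_def cyc_mod)
  have sum0: "(\<Sum>i\<in>{1..d}. c i) = 0"
    unfolding c_def d_def by (rule equal_image_periodic(2)[OF a b eq t n])
  let ?p = "\<lambda>j. nat (c j)" and ?q = "\<lambda>j. nat (- c j)"
  have "int (\<Sum>i\<in>{1..d}. ?p i) - int (\<Sum>i\<in>{1..d}. ?q i) = (\<Sum>i\<in>{1..d}. c i)"
    unfolding of_nat_sum sum_subtractf[symmetric] by (intro sum.cong) auto
  then have pq: "(\<Sum>i\<in>{1..d}. ?p i) = (\<Sum>i\<in>{1..d}. ?q i)"
    unfolding sum0 by linarith
  have red: "(\<Prod>j\<in>{1..n}. mvar j ^ f (c j)) - residue_monom n d d ^ (\<Sum>i\<in>{1..d}. f (c i)) \<in> I" for f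
    by (rule periodic_monomial_reduces[OF I d(1)]) (use gens cyc in \<open>auto simp: d_def\<close>)
  have "((\<Prod>j\<in>{1..n}. mvar j ^ ?p j) - residue_monom n d d ^ (\<Sum>i\<in>{1..d}. ?p i)) +
      - ((\<Prod>j\<in>{1..n}. mvar j ^ ?q j) - residue_monom n d d ^ (\<Sum>i\<in>{1..d}. ?q i)) \<in> I"
    by (intro mpoly_ideal_closed[OF I] red[of nat] red[of "\<lambda>x. nat (- x)"])
  then have diff: "(\<Prod>j\<in>{1..n}. mvar j ^ ?p j) - (\<Prod>j\<in>{1..n}. mvar j ^ ?q j) \<in> I"
    by (simp only: pq) (simp add: algebra_simps)
  let ?g = "\<Prod>j\<in>{1..n}. mvar j ^ min (?a j) (?b j) :: 'k mpoly"
  have "?g \<in> carrier (mpoly_ring n)"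
    by (intro mpoly_prod_closed mpoly_power_closed mvar_closed)
  then have "?g * ((\<Prod>j\<in>{1..n}. mvar j ^ ?p j) - (\<Prod>j\<in>{1..n}. mvar j ^ ?q j)) \<in> I"
    by (rule mpoly_ideal_closed(3)[OF I diff])
  moreover have "?g * (\<Prod>j\<in>{1..n}. mvar j ^ ?p j) = Poly_Mapping.single a 1"
    unfolding single_eq_prod_mvar[OF a] prod.distrib[symmetric] power_add[symmetric]
    by (intro prod.cong refl arg_cong2[where f = "(^)"]) (auto simp: c min_def nat_diff_distrib)
  moreover have "?g * (\<Prod>j\<in>{1..n}. mvar j ^ ?q j) = Poly_Mapping.single b 1"
    unfolding single_eq_prod_mvar[OF b] prod.distrib[symmetric] power_add[symmetric]
    by (intro prod.cong refl arg_cong2[where f = "(^)"]) (auto simp: c min_def nat_diff_distrib)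
  ultimately show ?thesis
    by (simp add: right_diff_distrib)
qed

text \<open>
  A ring map that sends monomials to monomials has a kernel spanned by binomials: modulo the binomials,
  every monomial of \<open>f\<close> may be replaced by a representative chosen for its image. The coefficient
  of such a representative is then the coefficient of the corresponding monomial of the image of
  \<open>f\<close>, which is zero.
\<close>

lemma path_map_kernel_in_ideal:
  fixes I :: "'k::field mpoly set"
  assumes I: "ideal I (mpoly_ring n)"
    and binomials: "\<And>a b. Poly_Mapping.keys a \<subseteq> {1..n} \<Longrightarrow> Poly_Mapping.keys b \<subseteq> {1..n} \<Longrightarrow>
            path_exp n t a = path_exp n t b \<Longrightarrow> Poly_Mapping.single a 1 - Poly_Mapping.single b 1 \<in> I"
    and f: "f \<in> carrier (mpoly_ring n)" and ker: "path_map n t f = 0"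
  shows "f \<in> I"
proof -
  \<comment> \<open>The chosen representative depends only on the image of \<open>m\<close>.\<close>
  define r where "r m = (SOME a. Poly_Mapping.keys a \<subseteq> {1..n} \<and> path_exp n t a = path_exp n t m)" for m
  have r: "Poly_Mapping.keys (r m) \<subseteq> {1..n} \<and> path_exp n t (r m) = path_exp n t m"
    if "Poly_Mapping.keys m \<subseteq> {1..n}" for m
    unfolding r_def by (rule someI[of _ m]) (use that in simp)
  have r_cong: "r m = r m'" if "path_exp n t m = path_exp n t m'" for m m'
    using that by (simp add: r_def)
  let ?c = "Poly_Mapping.lookup f" and ?K = "Poly_Mapping.keys f"
  have supp: "Poly_Mapping.keys m \<subseteq> {1..n}" if "m \<in> ?K" for m
    using f that by (simp add: mem_mpoly_ring)
  have coeff: "(\<Sum>m\<in>?K. ?c m when path_exp n t m = e) = 0" for e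
  proof -
    have "path_map n t f = (\<Sum>m\<in>?K. path_map n t (Poly_Mapping.single m (?c m)))"
      unfolding path_map_def
      by (subst mpoly_expand[of f], rule mpoly_subst_sum) (simp_all add: mconst_add)
    then have "0 = Poly_Mapping.lookup (\<Sum>m\<in>?K. Poly_Mapping.single (path_exp n t m) (?c m)) e"
      by (simp add: ker path_map_single)
    then show ?thesis by (simp add: lookup_sum lookup_single)
  qed
  have zero: "(\<Sum>m\<in>?K. Poly_Mapping.single (r m) (?c m)) = 0"
  proof (rule poly_mapping_eqI)
    fix k
    have "(\<Sum>m\<in>?K. ?c m when r m = k) = 0"
    proof (cases "\<exists>m0\<in>?K. r m0 = k")
      case True
      then obtain m0 where m0: "m0 \<in> ?K" "r m0 = k" by blast
      have "r m = k \<longleftrightarrow> path_exp n t m = path_exp n t m0" if "m \<in> ?K" for m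
        using r[OF supp[OF that]] r[OF supp[OF m0(1)]] r_cong m0(2) by metis
      then have "(\<Sum>m\<in>?K. ?c m when r m = k) = (\<Sum>m\<in>?K. ?c m when path_exp n t m = path_exp n t m0)"
        by (intro sum.cong) auto
      then show ?thesis by (simp add: coeff)
    next
      case False
      then show ?thesis by (intro sum.neutral) (auto simp: when_def)
    qed
    then show "Poly_Mapping.lookup (\<Sum>m\<in>?K. Poly_Mapping.single (r m) (?c m)) k = Poly_Mapping.lookup 0 k"
      by (simp add: lookup_sum lookup_single)
  qed
  have reduce: "Poly_Mapping.single m (?c m) - Poly_Mapping.single (r m) (?c m) \<in> I" if "m \<in> ?K" for m
  proof -
    have "mconst (?c m) * (Poly_Mapping.single m 1 - Poly_Mapping.single (r m) 1) \<in> I"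
      using r[OF supp[OF that]] supp[OF that]
      by (intro mpoly_ideal_closed[OF I] binomials mconst_closed) auto
    then show ?thesis by (simp add: mconst_def right_diff_distrib mult_single)
  qed
  have "f = f - (\<Sum>m\<in>?K. Poly_Mapping.single (r m) (?c m))"
    by (simp add: zero)
  also have "\<dots> = (\<Sum>m\<in>?K. Poly_Mapping.single m (?c m) - Poly_Mapping.single (r m) (?c m))"
    by (subst mpoly_expand[of f]) (simp add: sum_subtractf)
  also have "\<dots> \<in> I"
    by (rule closed_sum) (auto intro: mpoly_ideal_closed[OF I] reduce)
  finally show ?thesis .
qed

lemma mem_path_map_kernel:
  "f \<in> a_kernel (mpoly_ring n) (subalgebra_ring n (path_gens n t)) (path_map n t) \<longleftrightarrow>
     f \<in> carrier (mpoly_ring n) \<and> path_map n t f = 0"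
  by (simp add: a_kernel_def')

lemma path_map_kernel:
  fixes n t :: nat
  assumes t: "t > 0" and n: "n > 0"
  defines "d \<equiv> gcd n t"
  shows "a_kernel (mpoly_ring n) (subalgebra_ring n (path_gens n t)) (path_map n t) =
     Idl\<^bsub>mpoly_ring n\<^esub> ((\<lambda>i. residue_monom n d i - residue_monom n d d :: 'k::field mpoly) ` {1..<d})"
    (is "?ker = Idl\<^bsub>?R\<^esub> ?G")
proof
  interpret R: cring ?R by (rule cring_mpoly_ring)
  interpret A: cring "subalgebra_ring n (path_gens n t) :: 'k mpoly ring"
    by (rule cring_subalgebra_ring[OF path_gens_closed])
  interpret h: ring_hom_ring ?R "subalgebra_ring n (path_gens n t)" "path_map n t"
    by (intro ring_hom_ringI2 R.ring_axioms A.ring_axioms path_map_hom)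
  have G: "?G \<subseteq> carrier ?R"
  proof (rule image_subsetI)
    fix i
    show "residue_monom n d i - residue_monom n d d \<in> carrier ?R"
      using mpoly_closed(4)[OF residue_monom_closed mpoly_closed(3)[OF residue_monom_closed]] by simp
  qed
  have "?G \<subseteq> ?ker"
  proof (rule image_subsetI)
    fix i
    have "residue_monom n d i - residue_monom n d d \<in> carrier ?R"
      using mpoly_closed(4)[OF residue_monom_closed mpoly_closed(3)[OF residue_monom_closed]] by simp
    moreover have "path_map n t (residue_monom n d i - residue_monom n d d :: 'k mpoly) = 0"
    proof -
      have "path_map n t (residue_monom n d i - residue_monom n d d + residue_monom n d d :: 'k mpoly) =
          path_map n t (residue_monom n d i - residue_monom n d d) + path_map n t (residue_monom n d d)"
        unfolding path_map_def by (rule mpoly_subst_add) (simp_all add: mconst_add)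
      moreover have "path_map n t (residue_monom n d i) = (path_map n t (residue_monom n d d) :: 'k mpoly)"
        using n by (intro path_map_residue_monom) (simp_all add: d_def)
      ultimately show ?thesis by simp
    qed
    ultimately show "residue_monom n d i - residue_monom n d d \<in> ?ker"
      unfolding mem_path_map_kernel by (rule conjI)
  qed
  then show "Idl\<^bsub>?R\<^esub> ?G \<subseteq> ?ker"
    by (rule R.genideal_minimal[OF h.kernel_is_ideal])
  have I: "ideal (Idl\<^bsub>?R\<^esub> ?G) ?R"
    by (rule R.genideal_ideal[OF G])
  show "?ker \<subseteq> Idl\<^bsub>?R\<^esub> ?G"
  proof
    fix f assume "f \<in> ?ker"
    then have f: "f \<in> carrier ?R" "path_map n t f = 0"
      unfolding mem_path_map_kernel by blast+
    show "f \<in> Idl\<^bsub>?R\<^esub> ?G"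
    proof (rule path_map_kernel_in_ideal[OF I _ f])
      fix a b
      assume ab: "Poly_Mapping.keys a \<subseteq> {1..n}" "Poly_Mapping.keys b \<subseteq> {1..n}"
        "path_exp n t a = path_exp n t b"
      have "residue_monom n (gcd n t) i - residue_monom n (gcd n t) (gcd n t) \<in> Idl\<^bsub>?R\<^esub> ?G"
        if "i \<in> {1..<gcd n t}" for i
        unfolding d_def[symmetric]
        by (rule subsetD[OF R.genideal_self[OF G]], rule imageI) (use that in \<open>simp add: d_def\<close>)
      then show "Poly_Mapping.single a 1 - Poly_Mapping.single b 1 \<in> Idl\<^bsub>?R\<^esub> ?G"
        by (rule binomial_relation[OF I _ ab t n])
    qed
  qed
qed

section \<open>The fiber cone\<close>

definition mdeg :: "(nat \<Rightarrow>\<^sub>0 nat) \<Rightarrow> nat" where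
  "mdeg m = (\<Sum>i\<in>Poly_Mapping.keys m. Poly_Mapping.lookup m i)"

lemma mdeg_add: "mdeg (a + b) = mdeg a + mdeg b"
  unfolding mdeg_def by (rule setsum_keys_plus_distrib[where f = "\<lambda>_ v. v"]) simp_all

lemma mdeg_single: "mdeg (Poly_Mapping.single i k) = k"
  by (simp add: mdeg_def)

lemma mdeg_zero: "mdeg 0 = 0"
  by (simp add: mdeg_def)

lemma mdeg_sum: "mdeg (sum f A) = (\<Sum>i\<in>A. mdeg (f i))"
  by (induction A rule: infinite_finite_induct) (simp_all add: mdeg_add mdeg_zero)

text \<open>
  Grade \<open>S[s]\<close> by giving a monomial of degree \<open>e\<close> in the coefficient of \<open>s\<^sup>k\<close> the weight
  \<open>e - t k\<close>; this is the set of polynomials all of whose weights lie in \<open>D\<close>. The sets \<open>{0}\<close>,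
  \<open>{0..}\<close> and \<open>{1..}\<close> for \<open>D\<close> serve for the lifts, the Rees algebra, and the ideal that is divided
  out in the fiber cone.
\<close>

definition excess_in :: "nat \<Rightarrow> int set \<Rightarrow> 'k::field mpoly poly set" where
  "excess_in t D = {p. \<forall>k. \<forall>m\<in>Poly_Mapping.keys (Polynomial.coeff p k). int (mdeg m) - int (t * k) \<in> D}"

lemma excess_in_0: "0 \<in> excess_in t D"
  by (simp add: excess_in_def)

lemma excess_inD:
  "p \<in> excess_in t D \<Longrightarrow> m \<in> Poly_Mapping.keys (Polynomial.coeff p k) \<Longrightarrow> int (mdeg m) - int (t * k) \<in> D"
  unfolding excess_in_def by blast

lemma excess_in_add:
  assumes "p \<in> excess_in t D" "q \<in> excess_in t D"
  shows "p + q \<in> excess_in t D"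
  unfolding excess_in_def
proof (intro CollectI allI ballI)
  fix k m assume "m \<in> Poly_Mapping.keys (Polynomial.coeff (p + q) k)"
  then have "m \<in> Poly_Mapping.keys (Polynomial.coeff p k) \<union> Poly_Mapping.keys (Polynomial.coeff q k)"
    unfolding coeff_add by (rule subsetD[OF Poly_Mapping.keys_add])
  then show "int (mdeg m) - int (t * k) \<in> D"
    using assms by (blast dest: excess_inD)
qed

lemma excess_in_uminus: "p \<in> excess_in t D \<Longrightarrow> - p \<in> excess_in t D"
  by (simp add: excess_in_def keys_uminus_mpoly)

lemma excess_in_mult:
  assumes p: "p \<in> excess_in t D" and q: "q \<in> excess_in t E"
    and F: "\<And>x y. x \<in> D \<Longrightarrow> y \<in> E \<Longrightarrow> x + y \<in> F"
  shows "p * q \<in> excess_in t F"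
  unfolding excess_in_def
proof (intro CollectI allI ballI)
  fix k m assume "m \<in> Poly_Mapping.keys (Polynomial.coeff (p * q) k)"
  then have "m \<in> (\<Union>i\<in>{..k}. Poly_Mapping.keys (Polynomial.coeff p i * Polynomial.coeff q (k - i)))"
    unfolding coeff_mult by (rule subsetD[OF keys_sum])
  then obtain i where i: "i \<le> k"
    and "m \<in> Poly_Mapping.keys (Polynomial.coeff p i * Polynomial.coeff q (k - i))"
    by blast
  then obtain a b where *: "m = a + b" "a \<in> Poly_Mapping.keys (Polynomial.coeff p i)"
      "b \<in> Poly_Mapping.keys (Polynomial.coeff q (k - i))"
    using subsetD[OF Poly_Mapping.keys_mult] by blast
  have "(int (mdeg a) - int (t * i)) + (int (mdeg b) - int (t * (k - i))) \<in> F"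
    by (intro F excess_inD[OF p] excess_inD[OF q] *(2,3))
  moreover have "int (t * k) = int (t * i) + int (t * (k - i))"
    using i by (simp flip: of_nat_add distrib_left)
  ultimately show "int (mdeg m) - int (t * k) \<in> F"
    by (simp only: *(1) mdeg_add of_nat_add) (simp add: algebra_simps)
qed

lemma excess_in_1: "0 \<in> D \<Longrightarrow> 1 \<in> excess_in t D"
  by (auto simp: excess_in_def coeff_1 mdeg_zero split: if_splits)

lemma excess_in_const:
  "[:a:] \<in> excess_in t D \<longleftrightarrow> (\<forall>m\<in>Poly_Mapping.keys a. int (mdeg m) \<in> D)"
  by (force simp: excess_in_def coeff_pCons split: nat.splits)

lemma excess_in_path_gen: "0 \<in> D \<Longrightarrow> [:0, path_gen n t j:] \<in> excess_in t D"
  by (auto simp: excess_in_def coeff_pCons path_gen_single mdeg_sum mdeg_single split: nat.splits if_splits)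

text \<open>
  The ring map to the Rees algebra whose composition with the quotient map is \<open>fiber_map\<close>.
\<close>

abbreviation rees_lift :: "nat \<Rightarrow> nat \<Rightarrow> 'k::field mpoly \<Rightarrow> 'k mpoly poly" where
  "rees_lift n t \<equiv> mpoly_subst (\<lambda>c. [:mconst c:]) (\<lambda>i. [:0, path_gen n t i:])"

lemma rees_lift_homogeneous: "rees_lift n t f \<in> excess_in t {0}"
proof -
  have mul: "p * q \<in> excess_in t {0}" if "p \<in> excess_in t {0}" "q \<in> excess_in t {0}"
    for p q :: "'a mpoly poly"
    using that by (rule excess_in_mult) auto
  have pow: "p ^ k \<in> excess_in t {0}" if "p \<in> excess_in t {0}" for p :: "'a mpoly poly" and k
    by (induction k) (use that in \<open>auto intro: excess_in_1 mul\<close>)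
  show ?thesis
    unfolding mpoly_subst_def
    by (intro closed_sum closed_prod mul pow excess_in_path_gen excess_in_0 excess_in_1 excess_in_add)
       (auto simp: excess_in_const mconst_def mdeg_zero split: if_splits)
qed

lemma poly_rees_lift: "poly (rees_lift n t f) 1 = path_map n t f"
  by (simp add: mpoly_subst_def path_map_def poly_sum poly_prod)

text \<open>
  All terms with a given monomial \<open>m\<close> of degree \<open>e\<close> occur in the coefficient of a single power of
  \<open>s\<close>, namely \<open>e / t\<close>, so nothing cancels when \<open>s\<close> is set to 1.
\<close>

lemma homogeneous_eq_0:
  assumes p: "p \<in> excess_in t {0}" and t: "t > 0" and 1: "poly p 1 = 0"
  shows "p = (0 :: 'k::field mpoly poly)"
proof (rule poly_eqI, rule poly_mapping_eqI)
  fix k m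
  have zero: "Poly_Mapping.lookup (Polynomial.coeff p i) m = 0" if "mdeg m \<noteq> t * i" for i
  proof (rule ccontr)
    assume "Poly_Mapping.lookup (Polynomial.coeff p i) m \<noteq> 0"
    then have "int (mdeg m) - int (t * i) \<in> {0}"
      by (intro excess_inD[OF p]) (simp add: in_keys_iff)
    then have "int (mdeg m) = int (t * i)" by simp
    with that show False unfolding of_nat_eq_iff by contradiction
  qed
  show "Poly_Mapping.lookup (Polynomial.coeff p k) m = Poly_Mapping.lookup (Polynomial.coeff 0 k) m"
  proof (cases "mdeg m = t * k \<and> k \<le> degree p")
    case True
    have "0 = (\<Sum>i\<le>degree p. Poly_Mapping.lookup (Polynomial.coeff p i) m)"
      using 1 by (simp add: poly_altdef flip: lookup_sum)
    also have "\<dots> = (\<Sum>i\<in>{k}. Poly_Mapping.lookup (Polynomial.coeff p i) m)"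
      using True t by (intro sum.mono_neutral_right) (auto intro!: zero)
    finally show ?thesis by simp
  next
    case False
    then show ?thesis using zero[of k] by (auto simp: coeff_eq_0)
  qed
qed

lemma rees_lift_eq_0_iff:
  assumes "t > 0"
  shows "rees_lift n t f = 0 \<longleftrightarrow> path_map n t f = 0"
  using homogeneous_eq_0[OF rees_lift_homogeneous assms] poly_rees_lift[of n t f]
  by (metis poly_0)

text \<open>
  The generators of the Rees algebra are constants, of weight equal to their degree, and the
  \<open>u\<^sub>i s\<close>, of weight 0.
\<close>

lemma rees_algebra_excess:
  assumes "p \<in> carrier (rees_algebra n (path_gens n t))"
  shows "p \<in> excess_in t {0..}"
proof -
  interpret P: cring "poly_ring_over n :: 'a mpoly poly ring" by (rule cring_poly_ring_over)
  have neg: "\<ominus>\<^bsub>poly_ring_over n\<^esub> x = - x" if "x \<in> carrier (poly_ring_over n)" for x :: "'a mpoly poly"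
    using that by (intro P.minus_equality) (auto simp: mem_poly_ring_over mpoly_closed)
  let ?H = "(\<lambda>a. [:a:]) ` carrier (mpoly_ring n) \<union> (\<lambda>u. [:0, u:]) ` path_gens n t"
  have H: "?H \<subseteq> carrier (poly_ring_over n)"
    by (rule rees_generators_closed[OF path_gens_closed])
  have "p \<in> generate_ring (poly_ring_over n) ?H"
    using assms by (simp add: mem_rees_algebra)
  then show ?thesis
  proof (induction rule: generate_ring.induct)
    case one
    then show ?case by (simp add: excess_in_1)
  next
    case (incl h)
    then show ?case by (auto simp: path_gens_def excess_in_const intro: excess_in_path_gen)
  next
    case (a_inv h)
    then show ?case using P.generate_ring_in_carrier[OF H] by (simp add: neg excess_in_uminus)
  next
    case (eng_add h1 h2)
    then show ?case by (simp add: excess_in_add)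
  next
    case (eng_mult h1 h2)
    then show ?case by (auto intro: excess_in_mult)
  qed
qed

text \<open>
  Negatives come for free, as multiples by \<open>-1\<close>.
\<close>

lemma ideal_of_type_algebra:
  fixes A :: "('b::comm_ring_1, 'c) ring_scheme"
  assumes A: "cring A" "monoid.mult A = (*)" "one A = 1" "zero A = 0" "add A = (+)"
    and J: "J \<subseteq> carrier A" "0 \<in> J" "\<And>a b. a \<in> J \<Longrightarrow> b \<in> J \<Longrightarrow> a + b \<in> J"
      "\<And>a x. a \<in> J \<Longrightarrow> x \<in> carrier A \<Longrightarrow> x * a \<in> J"
  shows "ideal J A"
proof -
  interpret cring A by fact
  note ops = A(2-5)
  show ?thesis
  proof (rule idealI[OF ring_axioms])
    show "subgroup J (add_monoid A)"
    proof (rule add.subgroupI)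
      fix a assume a: "a \<in> J"
      have "\<ominus>\<^bsub>A\<^esub> a = (\<ominus>\<^bsub>A\<^esub> \<one>\<^bsub>A\<^esub>) \<otimes>\<^bsub>A\<^esub> a"
        using a J(1) by (subst l_minus) auto
      then show "\<ominus>\<^bsub>A\<^esub> a \<in> J"
        using J(4)[OF a, of "\<ominus>\<^bsub>A\<^esub> \<one>\<^bsub>A\<^esub>"] by (simp add: ops(1))
    qed (use J in \<open>auto simp: ops\<close>)
  qed (use J in \<open>auto simp: ops mult.commute\<close>)
qed

lemma max_ideal_mdeg:
  assumes "a \<in> max_ideal n" "m \<in> Poly_Mapping.keys a"
  shows "mdeg m > 0"
proof -
  interpret R: cring "mpoly_ring n :: 'a mpoly ring" by (rule cring_mpoly_ring)
  let ?J = "{p \<in> carrier (mpoly_ring n). \<forall>m\<in>Poly_Mapping.keys p. mdeg m > 0} :: 'a mpoly set"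
  have "ideal ?J (mpoly_ring n)"
  proof (rule ideal_of_type_algebra[OF cring_mpoly_ring])
    fix a b :: "'a mpoly" assume "a \<in> ?J" "b \<in> ?J"
    then show "a + b \<in> ?J"
      using subsetD[OF Poly_Mapping.keys_add[of a b]] by (blast intro: mpoly_closed)
  next
    fix a x :: "'a mpoly" assume "a \<in> ?J" "x \<in> carrier (mpoly_ring n)"
    moreover have "mdeg m > 0" if m: "m \<in> Poly_Mapping.keys (x * a)" for m
    proof -
      obtain b c where "m = b + c" "c \<in> Poly_Mapping.keys a"
        using subsetD[OF Poly_Mapping.keys_mult m] by blast
      then show ?thesis using \<open>a \<in> ?J\<close> by (simp add: mdeg_add)
    qed
    ultimately show "x * a \<in> ?J"
      by (simp add: mpoly_closed)
  qed (auto intro: mpoly_closed)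
  moreover have "mvar ` {1..n} \<subseteq> ?J"
    by (auto simp: mem_mpoly_ring mvar_def mdeg_single)
  ultimately have "max_ideal n \<subseteq> ?J"
    unfolding max_ideal_def by (rule R.genideal_minimal)
  then show ?thesis using assms by blast
qed

lemma max_ideal_carrier: "max_ideal n \<subseteq> carrier (mpoly_ring n :: 'k::field mpoly ring)"
proof -
  interpret R: cring "mpoly_ring n :: 'k mpoly ring" by (rule cring_mpoly_ring)
  interpret ideal "max_ideal n" "mpoly_ring n :: 'k mpoly ring"
    unfolding max_ideal_def by (intro R.genideal_ideal) (auto intro: mvar_closed)
  show ?thesis by (rule a_subset)
qed

lemma rees_max_ideal_excess:
  fixes p :: "'k::field mpoly poly"
  assumes "p \<in> rees_max_ideal n (path_gens n t)"
  shows "p \<in> excess_in t {1..}"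
proof -
  let ?A = "rees_algebra n (path_gens n t) :: 'k mpoly poly ring"
  interpret A: cring ?A by (rule cring_rees_algebra[OF path_gens_closed])
  let ?J = "carrier ?A \<inter> excess_in t {1..}"
  have "ideal ?J ?A"
  proof (rule ideal_of_type_algebra[OF A.cring_axioms])
    show "0 \<in> ?J" using A.zero_closed by (simp add: excess_in_0)
  next
    fix a b assume "a \<in> ?J" "b \<in> ?J"
    then show "a + b \<in> ?J"
      using A.a_closed[of a b] by (auto intro: excess_in_add)
  next
    fix a x assume "a \<in> ?J" "x \<in> carrier ?A"
    then show "x * a \<in> ?J"
      using A.m_closed[of x a] excess_in_mult[OF rees_algebra_excess[of x n t], of a "{1..}" "{1..}"] by auto
  qed auto
  moreover have "(\<lambda>a. [:a:]) ` max_ideal n \<subseteq> ?J"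
  proof (rule image_subsetI)
    fix a :: "'k mpoly" assume a: "a \<in> max_ideal n"
    then have "[:a:] \<in> carrier ?A"
      using max_ideal_carrier by (auto simp: mem_rees_algebra intro!: generate_ring.incl)
    moreover have "[:a:] \<in> excess_in t {1..}"
      using max_ideal_mdeg[OF a] by (fastforce simp: excess_in_const)
    ultimately show "[:a:] \<in> ?J" by blast
  qed
  ultimately have "rees_max_ideal n (path_gens n t) \<subseteq> ?J"
    unfolding rees_max_ideal_def by (rule A.genideal_minimal)
  then show ?thesis using assms by blast
qed

text \<open>
  The weights of a lift are 0, those of an element of the ideal are positive.
\<close>

lemma rees_lift_in_rees_max_ideal_iff:
  "rees_lift n t f \<in> rees_max_ideal n (path_gens n t) \<longleftrightarrow> rees_lift n t (f :: 'k::field mpoly) = 0"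
proof
  assume "rees_lift n t f \<in> rees_max_ideal n (path_gens n t)"
  then have "rees_lift n t f \<in> excess_in t {1..}"
    by (rule rees_max_ideal_excess)
  then have "Poly_Mapping.keys (Polynomial.coeff (rees_lift n t f) k) = {}" for k
    using rees_lift_homogeneous[of n t f] by (fastforce simp: excess_in_def)
  then show "rees_lift n t f = 0"
    by (intro poly_eqI) simp
next
  interpret ideal "rees_max_ideal n (path_gens n t) :: 'k mpoly poly set" "rees_algebra n (path_gens n t)"
    by (rule rees_max_ideal_ideal)
  show "rees_lift n t f = 0 \<Longrightarrow> rees_lift n t f \<in> rees_max_ideal n (path_gens n t)"
    using additive_subgroup.zero_closed[OF additive_subgroup_axioms] by simp
qed

lemma fiber_map_kernel:
  assumes "t > 0"
  shows "a_kernel (mpoly_ring n) (fiber_cone n (path_gens n t)) (fiber_map n t) =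
    (a_kernel (mpoly_ring n) (subalgebra_ring n (path_gens n t)) (path_map n t) :: 'k::field mpoly set)"
proof -
  let ?A = "rees_algebra n (path_gens n t) :: 'k mpoly poly ring"
  let ?I = "rees_max_ideal n (path_gens n t) :: 'k mpoly poly set"
  interpret ideal ?I ?A by (rule rees_max_ideal_ideal)
  have "fiber_map n t f = ?I \<longleftrightarrow> path_map n t f = 0" if f: "f \<in> carrier (mpoly_ring n)" for f :: "'k mpoly"
  proof -
    have "rees_lift n t f \<in> carrier ?A"
      using f by (intro mpoly_subst_closed[where n = n] cring_rees_algebra path_gens_closed)
         (auto simp: mem_rees_algebra path_gens_def intro: generate_ring.incl mconst_closed)
    then have "fiber_map n t f = ?I \<longleftrightarrow> rees_lift n t f \<in> ?I"
      unfolding fiber_map_def using a_coset_join1 a_coset_join2 a_subgroup by blast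
    then show ?thesis
      by (simp only: rees_lift_in_rees_max_ideal_iff rees_lift_eq_0_iff[OF assms])
  qed
  then show ?thesis
    by (auto simp: a_kernel_def' fiber_cone_def FactRing_def)
qed

theorem theorem3p2:
  fixes n t d :: nat
    and H' :: "'k::field mpoly set"
  assumes "1 < t" and "t < n - 1"
  defines "d \<equiv> gcd n t"
  defines "H' \<equiv> Idl\<^bsub>mpoly_ring n\<^esub> ((\<lambda>i. residue_monom n d i - residue_monom n d d) ` {1..<d})"
  shows "a_kernel (mpoly_ring n) (fiber_cone n (path_gens n t)) (fiber_map n t) = H'
       \<and> a_kernel (mpoly_ring n) (subalgebra_ring n (path_gens n t)) (path_map n t) = H'"
  unfolding H'_def d_def
  using assms(1,2) by (simp add: fiber_map_kernel path_map_kernel)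

end
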